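(* Let $\bar a=(a_1,\dots,a_s)$ be a composition of $n$, let $l$ be a positive integer with $2l\le\min_{i\in[s]}a_i$, and let $t$ be a positive real number. Then complementary sections of the chainlink polytope have the same relative volume, $$|\mathrm{CL}^t(\bar a,l)|=|\mathrm{CL}^{n-t}(\bar a,l)|.$$ In fact, their Ehrhart counting functions are identical: $\#\big(k\,\mathrm{CL}^t(\bar a,l)\cap\mathbb{Z}^s\big)=\#\big(k\,\mathrm{CL}^{n-t}(\bar a,l)\cap\mathbb{Z}^s\big)$ for every positive integer $k$.
   Context: A composition of $n$ is a tuple $\bar a=(a_1,\dots,a_s)$ of positive integers with $a_1+\dots+a_s=n$. The chainlink polytope is $$\mathrm{CL}(\bar a,l)=\{x\in\mathbb{R}^s : 0\le x_i\le a_i,\ x_i-x_{i+1}\le a_i-l \text{ for all } i\in[s]\},$$ with indices cyclic modulo $s$ (so $x_{s+1}=x_1$). For real $t$, its section is $\mathrm{CL}^t(\bar a,l)=\mathrm{CL}(\bar a,l)\cap\{x_1+\dots+x_s=t\}$. The relative volume $|P|$ of a polytope $P$ in a hyperplane $\{x_1+\dots+x_s=t\}$ is its $(s-1)$-dimensional volume, normalized (translation-invariantly) so that the simplex $\operatorname{conv}\{0,e_1-e_2,e_1-e_3,\dots,e_1-e_s\}$ has volume $1$. *)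

theory Defs
  imports "HOL-Analysis.Analysis"
begin

text \<open>
  The index set \<open>[s]\<close> is an arbitrary finite linearly ordered type \<open>'n\<close>, so that
  \<open>s = CARD('n) \<ge> 1\<close> and the ambient space is \<open>real ^ 'n\<close>.  The successor of an index is
  the next one in the order, and the largest index is followed by the smallest.
\<close>

definition cyc_succ :: "'n::{finite,linorder} \<Rightarrow> 'n" where
  "cyc_succ i = (if i = Max UNIV then Min UNIV else Min {j. i < j})"

definition composition :: "('n::finite \<Rightarrow> nat) \<Rightarrow> nat \<Rightarrow> bool" where
  "composition a n \<longleftrightarrow> (\<forall>i. 0 < a i) \<and> (\<Sum>i\<in>UNIV. a i) = n"

definition chainlink :: "('n::{finite,linorder} \<Rightarrow> nat) \<Rightarrow> nat \<Rightarrow> (real ^ 'n::{finite,linorder}) set" where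
  "chainlink a l =
     {x. \<forall>i. 0 \<le> x $ i \<and> x $ i \<le> real (a i) \<and>
             x $ i - x $ (cyc_succ i) \<le> real (a i) - real l}"

definition chainlink_section ::
    "('n::{finite,linorder} \<Rightarrow> nat) \<Rightarrow> nat \<Rightarrow> real \<Rightarrow> (real ^ 'n::{finite,linorder}) set" where
  "chainlink_section a l t = chainlink a l \<inter> {x. (\<Sum>i\<in>UNIV. x $ i) = t}"

text \<open>
  The Euclidean \<open>(s - 1)\<close>-dimensional volume of a set \<open>P\<close> lying in a hyperplane
  \<open>{x. (\<Sum>i\<in>UNIV. x $ i) = t}\<close> is the \<open>s\<close>-dimensional Lebesgue measure of the right prism of
  height \<open>1\<close> over \<open>P\<close>.  This also covers \<open>s = 1\<close>, where a point has volume \<open>1\<close>.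
\<close>

definition unit_normal :: "real ^ 'n::finite" where
  "unit_normal = (\<chi> i. 1 / sqrt (real CARD('n)))"

definition right_prism :: "(real ^ 'n::finite) set \<Rightarrow> (real ^ 'n) set" where
  "right_prism P = {x + u *\<^sub>R unit_normal | x u. x \<in> P \<and> 0 \<le> u \<and> u \<le> 1}"

definition hyperplane_volume :: "(real ^ 'n::finite) set \<Rightarrow> real" where
  "hyperplane_volume P = measure lebesgue (right_prism P)"

definition standard_simplex :: "(real ^ 'n::{finite,linorder}) set" where
  "standard_simplex =
     convex hull (insert 0 {axis (Min UNIV) 1 - axis i 1 | i. i \<noteq> Min UNIV})"

definition relative_volume :: "(real ^ 'n::{finite,linorder}) set \<Rightarrow> real" where
  "relative_volume P =
     hyperplane_volume P / hyperplane_volume (standard_simplex :: (real ^ 'n::{finite,linorder}) set)"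

definition lattice_points :: "(real ^ 'n::finite) set" where
  "lattice_points = {x. \<forall>i. x $ i \<in> \<int>}"

definition ehrhart_count :: "(real ^ 'n::finite) set \<Rightarrow> nat \<Rightarrow> nat" where
  "ehrhart_count P k = card ((\<lambda>x. real k *\<^sub>R x) ` P \<inter> lattice_points)"

text \<open>
  The volume of the standard simplex is shown to be nonzero, and the sets counted for the
  sections to be finite, so that the conventions \<open>x / 0 = 0\<close> and \<open>card A = 0\<close> for infinite \<open>A\<close>
  play no role.
\<close>

lemma norm_unit_normal: "norm (unit_normal :: real ^ 'n::finite) = 1"
  by (simp add: unit_normal_def norm_vec_def L2_set_def power_divide)

lemma right_prism_eq:
  "right_prism P = (\<lambda>(x, u). x + u *\<^sub>R unit_normal) ` (P \<times> {0..1})"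
  unfolding right_prism_def by force

lemma compact_right_prism:
  assumes "compact P" shows "compact (right_prism P)"
  unfolding right_prism_eq
  by (intro compact_continuous_image compact_Times assms compact_Icc)
     (auto simp: case_prod_unfold intro!: continuous_intros)

lemma convex_right_prism:
  fixes P :: "(real ^ 'n::finite) set"
  assumes "convex P" shows "convex (right_prism P)"
proof -
  have "linear (\<lambda>(x, u). x + u *\<^sub>R (unit_normal :: real ^ 'n))"
    by (intro linearI) (auto simp: algebra_simps)
  then show ?thesis
    unfolding right_prism_eq
    by (intro convex_linear_image convex_Times assms) auto
qed

lemma hyperplane_volume_standard_simplex_pos:
  "0 < hyperplane_volume (standard_simplex :: (real ^ 'n::{finite,linorder}) set)"
proof -
  let ?S = "standard_simplex :: (real ^ 'n::{finite,linorder}) set"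
  let ?W = "right_prism ?S"
  let ?m = "Min UNIV :: 'n"
  have cpt: "compact ?S"
    unfolding standard_simplex_def
    by (intro compact_convex_hull finite_imp_compact) auto
  have W: "compact ?W" "convex ?W"
    using cpt by (auto intro!: compact_right_prism convex_right_prism simp: standard_simplex_def)
  have S0: "0 \<in> ?S" and Si: "\<And>i. i \<noteq> ?m \<Longrightarrow> axis ?m 1 - axis i 1 \<in> ?S"
    unfolding standard_simplex_def by (auto intro!: hull_inc)
  have inW: "x \<in> ?W" if "x \<in> ?S" for x
    unfolding right_prism_def using that by (intro CollectI exI[of _ x] exI[of _ 0]) auto
  have nu: "unit_normal \<in> ?W"
    unfolding right_prism_def using S0 by (intro CollectI exI[of _ 0] exI[of _ 1]) auto
  have "interior ?W \<noteq> {}"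
  proof
    assume "interior ?W = {}"
    then obtain c b where c: "c \<noteq> 0" and sub: "?W \<subseteq> {x. c \<bullet> x = b}"
      using empty_interior_subset_hyperplane[OF W(2)] by metis
    have b: "b = 0" using sub inW[OF S0] by auto
    have const: "c $ i = c $ ?m" for i
    proof (cases "i = ?m")
      case False
      then have "c \<bullet> (axis ?m 1 - axis i 1) = 0" using sub inW[OF Si] b by auto
      then show ?thesis by (simp add: inner_diff_right inner_axis)
    qed auto
    have "c \<bullet> unit_normal = 0" using sub nu b by auto
    moreover have "c \<bullet> unit_normal = (\<Sum>i\<in>(UNIV :: 'n set). c $ ?m / sqrt (real CARD('n)))"
      unfolding inner_vec_def using const by (intro sum.cong) (simp_all add: unit_normal_def)
    ultimately have "real CARD('n) * (c $ ?m / sqrt (real CARD('n))) = 0"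
      by simp
    then have "c $ ?m = 0" by simp
    then have "c = 0" using const by (simp add: vec_eq_iff)
    with c show False by simp
  qed
  then have "\<not> negligible ?W"
    using negligible_convex_interior W(2) by blast
  then show ?thesis
    unfolding hyperplane_volume_def
    using W(1) lmeasurable_compact negligible_iff_measure zero_less_measure_iff by blast
qed

lemma relative_volume_standard_simplex:
  "relative_volume (standard_simplex :: (real ^ 'n::{finite,linorder}) set) = 1"
  using hyperplane_volume_standard_simplex_pos[where 'n = 'n]
  unfolding relative_volume_def by simp

lemma finite_ehrhart_points:
  "finite ((\<lambda>x. real k *\<^sub>R x) ` chainlink_section a l t \<inter> lattice_points)"
proof -
  let ?B = "\<lambda>i. {z :: int. 0 \<le> z \<and> z \<le> int (k * a i)}"
  have "(\<lambda>x. real k *\<^sub>R x) ` chainlink_section a l t \<inter> lattice_points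
      \<subseteq> (\<lambda>f. \<chi> i. real_of_int (f i)) ` (\<Pi>\<^sub>E i\<in>UNIV. ?B i)"
  proof
    fix y assume y: "y \<in> (\<lambda>x. real k *\<^sub>R x) ` chainlink_section a l t \<inter> lattice_points"
    have "0 \<le> y $ i \<and> y $ i \<le> real k * real (a i)" for i
      using y by (auto simp: chainlink_section_def chainlink_def intro!: mult_left_mono)
    moreover have fl: "real_of_int \<lfloor>y $ i\<rfloor> = y $ i" for i
      using y by (auto simp: lattice_points_def)
    ultimately have "0 \<le> \<lfloor>y $ i\<rfloor> \<and> \<lfloor>y $ i\<rfloor> \<le> int (k * a i)" for i
      by (metis (mono_tags, opaque_lifting) of_int_0_le_iff of_int_le_iff of_int_of_nat_eq of_nat_mult)
    then show "y \<in> (\<lambda>f. \<chi> i. real_of_int (f i)) ` (\<Pi>\<^sub>E i\<in>UNIV. ?B i)"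
      by (intro image_eqI[of _ _ "\<lambda>i. \<lfloor>y $ i\<rfloor>"]) (auto simp: vec_eq_iff fl)
  qed
  moreover have "finite (\<Pi>\<^sub>E i\<in>(UNIV :: 'a set). ?B i)"
    by (intro finite_PiE) auto
  ultimately show ?thesis by (meson finite_imageI finite_subset)
qed

end

theory Submission
  imports Defs
begin

text \<open>
  Dilate so that only lattice points matter, with \<open>c i = k * a i\<close> and \<open>L = k * l\<close>.  The
  \<open>i\<close>-th cyclic inequality is violated by \<open>z\<close> iff \<open>(c i - z i) + z (f i) < L\<close>, where \<open>f\<close> is the
  cyclic successor; as \<open>2 * L \<le> c i\<close>, consecutive inequalities are never both violated.
  Inclusion-exclusion therefore writes \<open>\<Sum>z. q ^ (\<Sum>i. z i)\<close> as a sum over the sets \<open>E\<close> disjoint from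
  \<open>f ` E\<close>.  Splitting each factor \<open>\<Sum>j\<le>c i. q ^ j = \<alpha> + \<delta> * q ^ c i\<close> with \<open>\<alpha> = 1 / (1 - q)\<close>,
  \<open>\<delta> = - q / (1 - q)\<close> and collecting the terms with exponent \<open>\<Sum>i\<in>I. c i\<close> gives the coefficient
  \<open>\<delta> ^ (|I| - d) * \<alpha> ^ (|- I| - d) * (\<delta> * \<alpha> - S) ^ d\<close>, where \<open>d\<close> counts the \<open>i \<in> I\<close> with \<open>f i \<notin> I\<close>.
  The substitution \<open>q \<mapsto> 1 / q\<close> swaps \<open>\<alpha>\<close> and \<open>\<delta>\<close> and fixes \<open>S\<close>, and \<open>d\<close> is the same for \<open>I\<close> and \<open>- I\<close>,
  so the generating function is palindromic.  The volume of a section is a limit of lattice point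
  counts, which transfers the symmetry to real \<open>t\<close>.
\<close>

section \<open>Inclusion-exclusion over violated inequalities\<close>

lemma prod_split_matching:
  fixes f :: "'n::finite \<Rightarrow> 'n" and h :: "'n \<Rightarrow> real"
  assumes "inj f" and E: "E \<inter> f ` E = {}"
  shows "prod h UNIV = (\<Prod>i\<in>E. h i) * (\<Prod>i\<in>E. h (f i)) * (\<Prod>i\<in>- (E \<union> f ` E). h i)"
proof -
  have "prod h UNIV = prod h (E \<union> f ` E \<union> - (E \<union> f ` E))"
    by (simp only: Compl_partition)
  also have "\<dots> = prod h (E \<union> f ` E) * prod h (- (E \<union> f ` E))"
    by (intro prod.union_disjoint) auto
  also have "prod h (E \<union> f ` E) = prod h E * prod h (f ` E)"
    using E by (intro prod.union_disjoint) auto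
  also have "prod h (f ` E) = (\<Prod>i\<in>E. h (f i))"
    using assms(1) by (subst prod.reindex) (auto intro: inj_on_subset)
  finally show ?thesis .
qed

text \<open>The \<open>S\<close> of the introductory text. With \<open>u = c i - z i\<close> and
  \<open>v = z (f i)\<close>, a violation at \<open>i\<close> reads \<open>u + v < L\<close>; the
  factor \<open>q ^ c i\<close> is split off so that the rest does not depend on
  \<open>i\<close>.\<close>

definition corner_sum :: "nat \<Rightarrow> real \<Rightarrow> real" where
  "corner_sum L q = (\<Sum>(u, v)\<in>{(u, v). u + v < L}. q ^ v / q ^ u)"

lemma finite_corner: "finite {(u, v). u + v < (L::nat)}"
  by (rule finite_subset[of _ "{..<L} \<times> {..<L}"]) auto

text \<open>Swapping \<open>u\<close> and \<open>v\<close> preserves the triangle and inverts each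
  summand.\<close>

lemma corner_sum_inverse: "corner_sum L (1 / q) = corner_sum L q"
  unfolding corner_sum_def
  by (rule sum.reindex_bij_witness[of _ "\<lambda>(u, v). (v, u)" "\<lambda>(u, v). (v, u)"])
     (auto simp: power_divide)

text \<open>The prescribed violations involve disjoint pairs of coordinates, so the sum factors:
  each pair runs over the corner triangle, every other coordinate over its full range. The bound
  \<open>L \<le> c i\<close> keeps the triangle inside the box.\<close>

lemma sum_matching:
  fixes f :: "'n::finite \<Rightarrow> 'n" and c :: "'n \<Rightarrow> nat" and q :: real
  assumes f: "inj f" and E: "E \<inter> f ` E = {}" and L: "\<And>i. L \<le> c i" and q: "q \<noteq> 0"
  shows "(\<Sum>z\<in>(\<Pi>\<^sub>E i\<in>UNIV. {..c i}). (\<Prod>i\<in>E. of_bool (c i + z (f i) < L + z i)) * (\<Prod>i\<in>UNIV. q ^ z i))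
       = (\<Prod>i\<in>- (E \<union> f ` E). \<Sum>j\<le>c i. q ^ j) * (\<Prod>i\<in>E. q ^ c i * corner_sum L q)"
proof -
  let ?T = "{(u, v). u + v < L}"
  let ?Z = "\<Pi>\<^sub>E i\<in>(UNIV::'n set). {..c i}"
  \<comment> \<open>\<open>g\<close> picks a corner point \<open>(u, v)\<close> for each index in
    \<open>E\<close>. The factor at \<open>j\<close> pins the coordinate to \<open>c j - u\<close>
    on \<open>E\<close> and to \<open>v\<close> on the image of \<open>E\<close>, and leaves it free
    elsewhere.\<close>
  define \<phi> where "\<phi> g j y = (if j \<in> E then of_bool (y = c j - fst (g j)) else
      if j \<in> f ` E then of_bool (y = snd (g (inv f j))) else 1) * q ^ y"
    for g :: "'n \<Rightarrow> nat \<times> nat" and j y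
  have fE: "f i \<notin> E" if "i \<in> E" for i using E that by auto
  \<comment> \<open>Only the pair \<open>(c i - x, y)\<close> can contribute;
    \<open>x \<le> c i\<close> and \<open>L \<le> c i\<close> make the truncated subtractions
    exact.\<close>
  have corner: "of_bool (c i + y < L + x) =
      (\<Sum>p\<in>?T. of_bool (x = c i - fst p) * of_bool (y = snd p) :: real)" if "x \<le> c i" for i x y
  proof (cases "c i + y < L + x")
    case True
    have "(\<Sum>p\<in>?T. of_bool (x = c i - fst p) * of_bool (y = snd p) :: real)
        = (\<Sum>p\<in>{(c i - x, y)}. 1)"
      using True that L[of i]
      by (intro sum.mono_neutral_cong_right finite_corner) auto
    then show ?thesis using True by simp
  next
    case False
    have "(\<Sum>p\<in>?T. of_bool (x = c i - fst p) * of_bool (y = snd p) :: real) = 0"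
      using False L[of i] by (intro sum.neutral) auto
    then show ?thesis using False by simp
  qed
  have "(\<Sum>z\<in>?Z. (\<Prod>i\<in>E. of_bool (c i + z (f i) < L + z i)) * (\<Prod>i\<in>UNIV. q ^ z i))
      = (\<Sum>z\<in>?Z. \<Sum>g\<in>(\<Pi>\<^sub>E i\<in>E. ?T). \<Prod>j\<in>UNIV. \<phi> g j (z j))"
  proof (rule sum.cong[OF refl])
    fix z assume z: "z \<in> ?Z"
    have "(\<Prod>i\<in>E. of_bool (c i + z (f i) < L + z i)) =
        (\<Prod>i\<in>E. \<Sum>p\<in>?T. of_bool (z i = c i - fst p) * of_bool (z (f i) = snd p) :: real)"
      using z by (intro prod.cong refl corner) auto
    also have "\<dots> = (\<Sum>g\<in>(\<Pi>\<^sub>E i\<in>E. ?T). \<Prod>i\<in>E.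
        of_bool (z i = c i - fst (g i)) * of_bool (z (f i) = snd (g i)))"
      by (intro prod_sum_PiE finite_corner) auto
    finally have "(\<Prod>i\<in>E. of_bool (c i + z (f i) < L + z i)) * (\<Prod>i\<in>UNIV. q ^ z i)
        = (\<Sum>g\<in>(\<Pi>\<^sub>E i\<in>E. ?T). (\<Prod>i\<in>E.
        of_bool (z i = c i - fst (g i)) * of_bool (z (f i) = snd (g i))) * (\<Prod>i\<in>UNIV. q ^ z i))"
      by (simp only: sum_distrib_right)
    also have "\<dots> = (\<Sum>g\<in>(\<Pi>\<^sub>E i\<in>E. ?T). \<Prod>j\<in>UNIV. \<phi> g j (z j))"
    proof (rule sum.cong[OF refl])
      fix g
      show "(\<Prod>i\<in>E. of_bool (z i = c i - fst (g i)) * of_bool (z (f i) = snd (g i)))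
          * (\<Prod>i\<in>UNIV. q ^ z i) = (\<Prod>j\<in>UNIV. \<phi> g j (z j))"
        unfolding prod_split_matching[OF f E] \<phi>_def
        by (simp add: fE f prod.distrib)
    qed
    finally show "(\<Prod>i\<in>E. of_bool (c i + z (f i) < L + z i)) * (\<Prod>i\<in>UNIV. q ^ z i)
        = (\<Sum>g\<in>(\<Pi>\<^sub>E i\<in>E. ?T). \<Prod>j\<in>UNIV. \<phi> g j (z j))" .
  qed
  also have "\<dots> = (\<Sum>g\<in>(\<Pi>\<^sub>E i\<in>E. ?T). \<Sum>z\<in>?Z. \<Prod>j\<in>UNIV. \<phi> g j (z j))"
    by (rule sum.swap)
  also have "\<dots> = (\<Sum>g\<in>(\<Pi>\<^sub>E i\<in>E. ?T). \<Prod>j\<in>UNIV. \<Sum>y\<le>c j. \<phi> g j y)"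
    by (intro sum.cong refl prod_sum_PiE[symmetric]) auto
  also have "\<dots> = (\<Sum>g\<in>(\<Pi>\<^sub>E i\<in>E. ?T). (\<Prod>i\<in>- (E \<union> f ` E). \<Sum>j\<le>c i. q ^ j) *
      (\<Prod>i\<in>E. q ^ c i * (case g i of (u, v) \<Rightarrow> q ^ v / q ^ u)))"
  proof (rule sum.cong[OF refl])
    fix g assume g: "g \<in> (\<Pi>\<^sub>E i\<in>E. ?T)"
    have 1: "(\<Sum>y\<le>c i. \<phi> g i y) = q ^ c i / q ^ fst (g i)" if "i \<in> E" for i
    proof -
      have "fst (g i) < L" using g that by (force simp: PiE_iff case_prod_unfold)
      then show ?thesis
        using that L[of i] q by (simp add: \<phi>_def power_diff)
    qed
    have 2: "(\<Sum>y\<le>c (f i). \<phi> g (f i) y) = q ^ snd (g i)" if "i \<in> E" for i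
    proof -
      have "snd (g i) < L" using g that by (force simp: PiE_iff case_prod_unfold)
      then show ?thesis
        using that L[of "f i"] q fE[OF that] f by (simp add: \<phi>_def)
    qed
    have 3: "(\<Prod>i\<in>- (E \<union> f ` E). \<Sum>y\<le>c i. \<phi> g i y) = (\<Prod>i\<in>- (E \<union> f ` E). \<Sum>y\<le>c i. q ^ y)"
      by (intro prod.cong refl) (simp add: \<phi>_def)
    show "(\<Prod>j\<in>UNIV. \<Sum>y\<le>c j. \<phi> g j y) = (\<Prod>i\<in>- (E \<union> f ` E). \<Sum>j\<le>c i. q ^ j) *
      (\<Prod>i\<in>E. q ^ c i * (case g i of (u, v) \<Rightarrow> q ^ v / q ^ u))"
      unfolding prod_split_matching[OF f E]
      unfolding 3 using 1 2
      by (simp add: case_prod_unfold mult.commute flip: prod.distrib cong: prod.cong)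
  qed
  also have "\<dots> = (\<Prod>i\<in>- (E \<union> f ` E). \<Sum>j\<le>c i. q ^ j) * (\<Prod>i\<in>E. q ^ c i * corner_sum L q)"
    unfolding corner_sum_def sum_distrib_left[symmetric]
    by (subst prod_sum_PiE[symmetric]) (auto simp: finite_corner[unfolded case_prod_unfold] sum_distrib_left case_prod_unfold)
  finally show ?thesis .
qed

definition chain_box :: "('n \<Rightarrow> 'n) \<Rightarrow> ('n \<Rightarrow> nat) \<Rightarrow> nat \<Rightarrow> ('n \<Rightarrow> nat) set" where
  "chain_box f c L = {z. \<forall>i. z i \<le> c i \<and> z i + L \<le> z (f i) + c i}"

lemma chain_box_subset: "chain_box f c L \<subseteq> (\<Pi>\<^sub>E i\<in>UNIV. {..c i})"
  by (auto simp: chain_box_def)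

lemma finite_chain_box: "finite (chain_box f c L :: ('n::finite \<Rightarrow> nat) set)"
  by (rule finite_subset[OF chain_box_subset]) (auto intro: finite_PiE)

text \<open>The indicator of the chain box is the product of \<open>1 - v i\<close> over the
  violation indicators \<open>v i\<close>. Expanding it over subsets \<open>E\<close> leaves only
  those that miss their image, and \<open>sum_matching\<close> evaluates these.\<close>

lemma chain_box_generating_function:
  fixes f :: "'n::finite \<Rightarrow> 'n" and c :: "'n \<Rightarrow> nat" and q :: real
  assumes f: "inj f" and L: "\<And>i. 2 * L \<le> c i" and q: "q \<noteq> 0"
  shows "(\<Sum>z\<in>chain_box f c L. q ^ (\<Sum>i\<in>UNIV. z i)) =
    (\<Sum>E | E \<inter> f ` E = {}. (\<Prod>i\<in>- (E \<union> f ` E). \<Sum>j\<le>c i. q ^ j) * (\<Prod>i\<in>E. - (q ^ c i * corner_sum L q)))"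
proof -
  let ?Z = "\<Pi>\<^sub>E i\<in>(UNIV::'n set). {..c i}"
  let ?v = "\<lambda>z i. of_bool (c i + z (f i) < L + z i) :: real"
  have L': "L \<le> c i" for i using L[of i] by simp
  have "(\<Sum>z\<in>chain_box f c L. q ^ (\<Sum>i\<in>UNIV. z i)) =
      (\<Sum>z\<in>?Z. (\<Prod>i\<in>UNIV. - ?v z i + 1) * (\<Prod>i\<in>UNIV. q ^ z i))"
  proof (rule sum.mono_neutral_cong_left[OF _ chain_box_subset])
    show "finite ?Z" by (auto intro: finite_PiE)
    show "\<forall>z\<in>?Z - chain_box f c L. (\<Prod>i\<in>UNIV. - ?v z i + 1) * (\<Prod>i\<in>UNIV. q ^ z i) = 0"
    proof
      fix z assume "z \<in> ?Z - chain_box f c L"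
      then obtain i where "\<not> (z i + L \<le> z (f i) + c i)" by (auto simp: chain_box_def)
      then have "- ?v z i + 1 = 0" by simp
      then have "(\<Prod>i\<in>UNIV. - ?v z i + 1) = 0" by (meson UNIV_I finite prod_zero)
      then show "(\<Prod>i\<in>UNIV. - ?v z i + 1) * (\<Prod>i\<in>UNIV. q ^ z i) = 0" by simp
    qed
    fix z assume z: "z \<in> chain_box f c L"
    have "- ?v z i + 1 = 1" for i
    proof -
      have "z i + L \<le> z (f i) + c i" using z by (simp add: chain_box_def)
      then show ?thesis by simp
    qed
    then show "q ^ (\<Sum>i\<in>UNIV. z i) = (\<Prod>i\<in>UNIV. - ?v z i + 1) * (\<Prod>i\<in>UNIV. q ^ z i)"
      by (simp add: power_sum)
  qed
  also have "\<dots> = (\<Sum>z\<in>?Z. \<Sum>E\<in>UNIV. (\<Prod>i\<in>E. - ?v z i) * (\<Prod>i\<in>UNIV. q ^ z i))"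
    by (subst prod_add) (simp_all add: sum_distrib_right)
  also have "\<dots> = (\<Sum>E\<in>UNIV. \<Sum>z\<in>?Z. (\<Prod>i\<in>E. - ?v z i) * (\<Prod>i\<in>UNIV. q ^ z i))"
    by (rule sum.swap)
  also have "\<dots> = (\<Sum>E | E \<inter> f ` E = {}. \<Sum>z\<in>?Z. (\<Prod>i\<in>E. - ?v z i) * (\<Prod>i\<in>UNIV. q ^ z i))"
  proof (rule sum.mono_neutral_right)
    show "\<forall>E\<in>UNIV - {E. E \<inter> f ` E = {}}. (\<Sum>z\<in>?Z. (\<Prod>i\<in>E. - ?v z i) * (\<Prod>i\<in>UNIV. q ^ z i)) = 0"
    proof (intro ballI sum.neutral)
      fix E z assume "E \<in> UNIV - {E. E \<inter> f ` E = {}}" and z: "z \<in> ?Z"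
      then obtain i where i: "i \<in> E" "f i \<in> E" by auto
      have "z i \<le> c i" using z by auto
      \<comment> \<open>A violation at \<open>i\<close> forces \<open>z (f i) < L\<close>, one at \<open>f i\<close> forces \<open>c (f i) - L < z (f i)\<close>.\<close>
      then have "- ?v z i = 0 \<or> - ?v z (f i) = 0"
        using L[of "f i"] by auto
      then have "(\<Prod>i\<in>E. - ?v z i) = 0"
        using i by (meson finite prod_zero)
      then show "(\<Prod>i\<in>E. - ?v z i) * (\<Prod>i\<in>UNIV. q ^ z i) = 0" by simp
    qed
  qed auto
  also have "\<dots> = (\<Sum>E | E \<inter> f ` E = {}. (\<Prod>i\<in>- (E \<union> f ` E). \<Sum>j\<le>c i. q ^ j)
      * (\<Prod>i\<in>E. - (q ^ c i * corner_sum L q)))"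
  proof (rule sum.cong[OF refl])
    fix E assume "E \<in> {E. E \<inter> f ` E = {}}"
    then have E: "E \<inter> f ` E = {}" by simp
    have "(\<Sum>z\<in>?Z. (\<Prod>i\<in>E. - ?v z i) * (\<Prod>i\<in>UNIV. q ^ z i))
        = (-1) ^ card E * (\<Sum>z\<in>?Z. (\<Prod>i\<in>E. ?v z i) * (\<Prod>i\<in>UNIV. q ^ z i))"
      by (simp only: prod_uminus sum_distrib_left mult.assoc)
    then show "(\<Sum>z\<in>?Z. (\<Prod>i\<in>E. - ?v z i) * (\<Prod>i\<in>UNIV. q ^ z i)) =
        (\<Prod>i\<in>- (E \<union> f ` E). \<Sum>j\<le>c i. q ^ j) * (\<Prod>i\<in>E. - (q ^ c i * corner_sum L q))"
      unfolding sum_matching[OF f E L' q] prod_uminus by simp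
  qed
  finally show ?thesis .
qed

section \<open>Regrouping the expansion by exponent sets\<close>

text \<open>If \<open>f\<close> is a single cycle and \<open>I\<close> a proper subset, these are
  the last elements of the maximal runs of \<open>I\<close>.\<close>

definition descents :: "('n \<Rightarrow> 'n) \<Rightarrow> 'n set \<Rightarrow> 'n set" where
  "descents f I = {i \<in> I. f i \<notin> I}"

text \<open>\<open>I\<close> and its preimage under \<open>f\<close> have the same size; removing
  their common part leaves the exits from \<open>I\<close> and the entries into \<open>I\<close>,
  and the entries are the descents of \<open>- I\<close>.\<close>

lemma card_descents_compl:
  fixes f :: "'n::finite \<Rightarrow> 'n"
  assumes "inj f"
  shows "card (descents f (- I)) = card (descents f I)"
proof -
  have "bij f" using assms by (simp add: bij_def finite_UNIV_inj_surj)
  then have "card (f -` I) = card I"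
    by (intro card_vimage_inj assms) (auto simp: bij_def)
  moreover have "card I = card (I \<inter> f -` I) + card (descents f I)"
    by (subst card_Un_disjoint[symmetric]) (auto simp: descents_def intro!: arg_cong[where f = card])
  moreover have "card (f -` I) = card (I \<inter> f -` I) + card (descents f (- I))"
    by (subst card_Un_disjoint[symmetric]) (auto simp: descents_def intro!: arg_cong[where f = card])
  ultimately show ?thesis by simp
qed

lemma card_descents_le:
  fixes f :: "'n::finite \<Rightarrow> 'n"
  assumes "inj f"
  shows "card (descents f I) \<le> card I" "card (descents f I) \<le> card (- I)"
  using card_mono[of I "descents f I"] card_mono[of "- I" "descents f (- I)"]
    card_descents_compl[OF assms, of I] by (auto simp: descents_def)

text \<open>Expanding the first product picks a set \<open>X\<close> of indices that take
  \<open>\<delta> * Q i\<close>; regroup by \<open>I = E \<union> X\<close>. For fixed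
  \<open>I\<close> the admissible \<open>E\<close> are exactly the subsets of
  \<open>descents f I\<close>, and summing over them is a binomial expansion.\<close>

lemma matching_resummation:
  fixes f :: "'n::finite \<Rightarrow> 'n" and Q :: "'n \<Rightarrow> real"
  assumes f: "inj f"
  shows "(\<Sum>E | E \<inter> f ` E = {}. (\<Prod>i\<in>- (E \<union> f ` E). \<alpha> + \<delta> * Q i) * (\<Prod>i\<in>E. \<gamma> * Q i)) =
    (\<Sum>I\<in>UNIV. (\<Prod>i\<in>I. Q i) * (\<delta> ^ (card I - card (descents f I)) *
       \<alpha> ^ (card (- I) - card (descents f I)) * (\<gamma> + \<delta> * \<alpha>) ^ card (descents f I)))"
proof -
  let ?M = "{E. E \<inter> f ` E = {}}"
  let ?h = "\<lambda>I E. \<gamma> ^ card E * \<delta> ^ (card I - card E) * \<alpha> ^ (card (- I) - card E) * prod Q I"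
  have "(\<Sum>E\<in>?M. (\<Prod>i\<in>- (E \<union> f ` E). \<alpha> + \<delta> * Q i) * (\<Prod>i\<in>E. \<gamma> * Q i)) =
      (\<Sum>E\<in>?M. \<Sum>X\<in>Pow (- (E \<union> f ` E)). (\<Prod>i\<in>X. \<delta> * Q i) * (\<Prod>i\<in>- (E \<union> f ` E) - X. \<alpha>) * (\<Prod>i\<in>E. \<gamma> * Q i))"
    by (subst add.commute, subst prod_add) (simp_all add: sum_distrib_right)
  also have "\<dots> = (\<Sum>(E, X)\<in>Sigma ?M (\<lambda>E. Pow (- (E \<union> f ` E))).
      (\<Prod>i\<in>X. \<delta> * Q i) * (\<Prod>i\<in>- (E \<union> f ` E) - X. \<alpha>) * (\<Prod>i\<in>E. \<gamma> * Q i))"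
    by (rule sum.Sigma) auto
  also have "\<dots> = (\<Sum>(I, E)\<in>Sigma UNIV (\<lambda>I. Pow (descents f I)). ?h I E)"
  proof (rule sum.reindex_bij_witness[of _ "\<lambda>(I, E). (E, I - E)" "\<lambda>(E, X). (E \<union> X, E)"], goal_cases)
    case (5 p)
    obtain E X where p: "p = (E, X)" by force
    have E: "E \<inter> f ` E = {}" and X: "X \<subseteq> - (E \<union> f ` E)" using 5 p by auto
    have EX: "E \<inter> X = {}" and cE: "card (f ` E) = card E"
      using X f by (auto intro: card_image inj_on_subset)
    have cI: "card (E \<union> X) = card E + card X" using EX by (simp add: card_Un_disjoint)
    \<comment> \<open>Outside \<open>I\<close> lie the partners of \<open>E\<close>, which carry no
      factor of their own, and the indices that took \<open>\<alpha>\<close>; hence the exponent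
      \<open>card (- I) - card E\<close>.\<close>
    have "- (E \<union> X) = f ` E \<union> (- (E \<union> f ` E) - X)" using E X by auto
    then have cC: "card (- (E \<union> X)) = card E + card (- (E \<union> f ` E) - X)"
      using cE by (simp add: card_Un_disjoint[of "f ` E"] Int_commute disjoint_iff)
    show ?case
      unfolding p prod.case cI cC using EX
      by (simp add: prod.distrib prod.union_disjoint)
  qed (auto simp: descents_def)
  also have "\<dots> = (\<Sum>I\<in>UNIV. \<Sum>E\<in>Pow (descents f I). ?h I E)"
    by (rule sum.Sigma[symmetric]) auto
  also have "\<dots> = (\<Sum>I\<in>UNIV. prod Q I * (\<delta> ^ (card I - card (descents f I)) *
       \<alpha> ^ (card (- I) - card (descents f I)) * (\<gamma> + \<delta> * \<alpha>) ^ card (descents f I)))"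
  proof (rule sum.cong[OF refl])
    fix I
    let ?D = "descents f I"
    have "?h I E = prod Q I * (\<delta> ^ (card I - card ?D) * \<alpha> ^ (card (- I) - card ?D)
        * ((\<Prod>i\<in>E. \<gamma>) * (\<Prod>i\<in>?D - E. \<delta> * \<alpha>)))" if "E \<in> Pow ?D" for E
    proof -
      have E: "card E \<le> card ?D" "card (?D - E) = card ?D - card E"
        using that by (auto intro: card_mono card_Diff_subset)
      \<comment> \<open>Each descent outside \<open>E\<close> supplies one \<open>\<delta>\<close>
        and one \<open>\<alpha>\<close>; \<open>card_descents_le\<close> makes the truncated
        differences exact.\<close>
      have "card I - card E = (card I - card ?D) + (card ?D - card E)"
        "card (- I) - card E = (card (- I) - card ?D) + (card ?D - card E)"
        using E card_descents_le[OF f, of I] by auto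
      then show ?thesis
        by (simp only: E power_add prod_constant power_mult_distrib mult_ac)
    qed
    then have "(\<Sum>E\<in>Pow ?D. ?h I E) = (\<Sum>E\<in>Pow ?D. prod Q I * (\<delta> ^ (card I - card ?D) * \<alpha> ^ (card (- I) - card ?D)
        * ((\<Prod>i\<in>E. \<gamma>) * (\<Prod>i\<in>?D - E. \<delta> * \<alpha>))))"
      by (rule sum.cong[OF refl])
    also have "\<dots> = prod Q I * (\<delta> ^ (card I - card ?D) * \<alpha> ^ (card (- I) - card ?D) * (\<Prod>i\<in>?D. \<gamma> + \<delta> * \<alpha>))"
      by (subst prod_add) (simp_all only: finite sum_distrib_left)
    finally show "(\<Sum>E\<in>Pow ?D. ?h I E) = prod Q I * (\<delta> ^ (card I - card ?D) *
       \<alpha> ^ (card (- I) - card ?D) * (\<gamma> + \<delta> * \<alpha>) ^ card ?D)"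
      by simp
  qed
  finally show ?thesis .
qed

section \<open>Palindromicity and Ehrhart counts\<close>

text \<open>The values 0 and 1 are avoided so that the geometric sums have closed forms at both
  \<open>q\<close> and \<open>1 / q\<close>; the remaining points suffice to compare
  polynomials.\<close>

lemma chain_box_palindromic:
  fixes f :: "'n::finite \<Rightarrow> 'n" and c :: "'n \<Rightarrow> nat" and q :: real
  assumes f: "inj f" and L: "\<And>i. 2 * L \<le> c i" and q: "q > 0" "q \<noteq> 1"
  shows "(\<Sum>z\<in>chain_box f c L. q ^ (\<Sum>i\<in>UNIV. z i)) =
    q ^ (\<Sum>i\<in>UNIV. c i) * (\<Sum>z\<in>chain_box f c L. (1 / q) ^ (\<Sum>i\<in>UNIV. z i))"
proof -
  define S where "S = corner_sum L q"
  \<comment> \<open>The coefficient from \<open>matching_resummation\<close> with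
    \<open>\<gamma> = - S\<close>, kept as a function of \<open>\<alpha>\<close> and
    \<open>\<delta>\<close> so that they can be exchanged.\<close>
  define g where "g \<alpha> \<delta> I = \<delta> ^ (card I - card (descents f I)) *
       \<alpha> ^ (card (- I) - card (descents f I)) * (- S + \<delta> * \<alpha>) ^ card (descents f I)"
    for \<alpha> \<delta> :: real and I :: "'n set"
  have gf: "(\<Sum>z\<in>chain_box f c L. r ^ (\<Sum>i\<in>UNIV. z i)) =
      (\<Sum>I\<in>UNIV. (\<Prod>i\<in>I. r ^ c i) * g (1 / (1 - r)) (- r / (1 - r)) I)"
    if r: "r \<noteq> 0" "r \<noteq> 1" "corner_sum L r = S" for r
  proof -
    have "(\<Sum>j\<le>k. r ^ j) = 1 / (1 - r) + (- r / (1 - r)) * r ^ k" for k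
      using sum_gp0[of r k] r by (simp add: diff_divide_distrib)
    then have "(\<Sum>z\<in>chain_box f c L. r ^ (\<Sum>i\<in>UNIV. z i)) =
      (\<Sum>E | E \<inter> f ` E = {}. (\<Prod>i\<in>- (E \<union> f ` E). 1 / (1 - r) + (- r / (1 - r)) * r ^ c i)
        * (\<Prod>i\<in>E. (- S) * r ^ c i))"
      unfolding chain_box_generating_function[OF f L r(1)] r(3) by (simp add: mult.commute)
    then show ?thesis
      unfolding matching_resummation[OF f] g_def .
  qed
  \<comment> \<open>Passing to \<open>1 / q\<close> exchanges \<open>\<alpha>\<close> and
    \<open>\<delta>\<close>.\<close>
  have 1: "1 / (1 - 1 / q) = - q / (1 - q)" "- (1 / q) / (1 - 1 / q) = 1 / (1 - q)"
    using q by (simp_all add: divide_simps) (simp add: algebra_simps)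
  have "q ^ (\<Sum>i\<in>UNIV. c i) * (\<Sum>z\<in>chain_box f c L. (1 / q) ^ (\<Sum>i\<in>UNIV. z i)) =
      (\<Sum>I\<in>UNIV. (\<Prod>i\<in>UNIV. q ^ c i) * (\<Prod>i\<in>I. (1 / q) ^ c i) * g (- q / (1 - q)) (1 / (1 - q)) I)"
    using gf[of "1 / q", unfolded 1] q
    by (simp add: corner_sum_inverse S_def sum_distrib_left power_sum mult.assoc)
  also have "\<dots> = (\<Sum>I\<in>UNIV. (\<Prod>i\<in>- I. q ^ c i) * g (1 / (1 - q)) (- q / (1 - q)) (- I))"
  proof (rule sum.cong[OF refl])
    fix I :: "'n set"
    have "(\<Prod>i\<in>UNIV. q ^ c i) = (\<Prod>i\<in>I. q ^ c i) * (\<Prod>i\<in>- I. q ^ c i)"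
      by (subst prod.union_disjoint[symmetric]) (auto simp: Compl_partition)
    moreover have "(\<Prod>i\<in>I. q ^ c i) * (\<Prod>i\<in>I. (1 / q) ^ c i) = 1"
      using q by (simp add: prod.distrib[symmetric] power_mult_distrib[symmetric])
    ultimately have "(\<Prod>i\<in>UNIV. q ^ c i) * (\<Prod>i\<in>I. (1 / q) ^ c i) = (\<Prod>i\<in>- I. q ^ c i)"
      by (simp add: mult.commute mult.left_commute)
    \<comment> \<open>Exchanging \<open>\<alpha>\<close> and \<open>\<delta>\<close> has the same
      effect on \<open>g\<close> as replacing \<open>I\<close> by \<open>- I\<close>.\<close>
    then show "(\<Prod>i\<in>UNIV. q ^ c i) * (\<Prod>i\<in>I. (1 / q) ^ c i) * g (- q / (1 - q)) (1 / (1 - q)) I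
        = (\<Prod>i\<in>- I. q ^ c i) * g (1 / (1 - q)) (- q / (1 - q)) (- I)"
      by (simp add: g_def card_descents_compl[OF f] mult_ac)
  qed
  also have "\<dots> = (\<Sum>I\<in>UNIV. (\<Prod>i\<in>I. q ^ c i) * g (1 / (1 - q)) (- q / (1 - q)) I)"
    by (rule sum.reindex_bij_witness[of _ uminus uminus]) auto
  also have "\<dots> = (\<Sum>z\<in>chain_box f c L. q ^ (\<Sum>i\<in>UNIV. z i))"
    using gf[of q] q by (simp add: S_def)
  finally show ?thesis ..
qed

definition chain_level :: "('n::finite \<Rightarrow> 'n) \<Rightarrow> ('n \<Rightarrow> nat) \<Rightarrow> nat \<Rightarrow> nat \<Rightarrow> ('n \<Rightarrow> nat) set" where
  "chain_level f c L m = {z \<in> chain_box f c L. (\<Sum>i\<in>UNIV. z i) = m}"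

lemma finite_chain_level: "finite (chain_level f c L m)"
  unfolding chain_level_def by (intro finite_subset[OF _ finite_chain_box[of f c L]]) auto

lemma chain_box_sum_le: "z \<in> chain_box f c L \<Longrightarrow> (\<Sum>i\<in>UNIV. z i) \<le> (\<Sum>i\<in>UNIV. c i)"
  for c :: "'n::finite \<Rightarrow> nat"
  by (intro sum_mono) (simp add: chain_box_def)

text \<open>The generating polynomial of the level counts and its reversal agree at every
  \<open>q > 1\<close> by palindromicity, hence coincide; compare the coefficients at
  \<open>m\<close>.\<close>

lemma card_chain_level_symmetric:
  fixes f :: "'n::finite \<Rightarrow> 'n" and c :: "'n \<Rightarrow> nat"
  assumes f: "inj f" and L: "\<And>i. 2 * L \<le> c i" and m: "m \<le> (\<Sum>i\<in>UNIV. c i)"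
  shows "card (chain_level f c L ((\<Sum>i\<in>UNIV. c i) - m)) = card (chain_level f c L m)"
proof -
  let ?N = "\<Sum>i\<in>UNIV. c i" and ?B = "chain_box f c L" and ?s = "\<lambda>z. \<Sum>i\<in>UNIV. z i :: nat"
  define P where "P = (\<Sum>z\<in>?B. monom (1::real) (?s z))"
  \<comment> \<open>\<open>R\<close> is \<open>q ^ ?N\<close> times \<open>P\<close> at
    \<open>1 / q\<close>; \<open>chain_box_sum_le\<close> ensures that no exponent is
    truncated.\<close>
  define R where "R = (\<Sum>z\<in>?B. monom (1::real) (?N - ?s z))"
  have "poly P q = poly R q" if "q \<in> {1<..}" for q
  proof -
    have q: "q > 0" "q \<noteq> 1" using that by auto
    have "poly P q = (\<Sum>z\<in>?B. q ^ ?N * (1 / q) ^ ?s z)"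
      using chain_box_palindromic[OF f L q]
      by (simp add: P_def poly_sum poly_monom sum_distrib_left)
    also have "\<dots> = poly R q"
      unfolding R_def poly_sum poly_monom
      using q chain_box_sum_le[of _ f c L]
      by (intro sum.cong refl) (simp add: power_diff power_divide)
    finally show ?thesis .
  qed
  then have "{1<..} \<subseteq> {q. poly (P - R) q = 0}" by auto
  moreover have "infinite {1::real<..}" by (simp add: infinite_Ioi)
  ultimately have "P - R = 0"
    using poly_roots_finite finite_subset by blast
  moreover have "coeff P m = real (card (chain_level f c L m))"
    using finite_chain_box[of f c L]
    by (simp add: P_def coeff_sum chain_level_def sum.If_cases Int_def flip: of_bool_def)
  moreover have "coeff R m = real (card (chain_level f c L (?N - m)))"
  proof -
    have "(?N - ?s z = m) = (?s z = ?N - m)" if "z \<in> ?B" for z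
      using chain_box_sum_le[OF that] m by auto
    then have "{z \<in> ?B. ?N - ?s z = m} = chain_level f c L (?N - m)"
      by (auto simp: chain_level_def)
    then show ?thesis
      using finite_chain_box[of f c L]
      by (simp add: R_def coeff_sum sum.If_cases Int_def)
  qed
  ultimately show ?thesis by simp
qed

section \<open>Lattice points of dilated sections\<close>

text \<open>Below the maximum the successor is strictly increasing, as
  \<open>cyc_succ i \<le> j < cyc_succ j\<close>; the maximum goes to \<open>Min UNIV\<close>, which
  is below every other successor.\<close>

lemma inj_cyc_succ: "inj (cyc_succ :: 'n::{finite,linorder} \<Rightarrow> 'n)"
proof (rule linorder_injI)
  fix i j :: 'n assume ij: "i < j"
  have gt: "k < cyc_succ k" if "k \<noteq> Max UNIV" for k :: 'n
  proof -
    have "k < Max UNIV" using that by (simp add: order_less_le)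
    then have "Min {j. k < j} \<in> {j. k < j}" by (intro Min_in) auto
    then show ?thesis using that by (simp add: cyc_succ_def)
  qed
  have i: "i \<noteq> Max UNIV" using ij by (metis Max_ge UNIV_I finite leD)
  have "cyc_succ i \<le> j" using i ij by (simp add: cyc_succ_def)
  moreover have "Min UNIV < cyc_succ i"
    using gt[OF i] by (meson Min_le UNIV_I finite le_less_trans)
  ultimately show "cyc_succ i \<noteq> cyc_succ j"
    using gt[of j] by (cases "j = Max UNIV") (auto simp: cyc_succ_def)
qed

lemma scaled_mem_chainlink_iff:
  assumes "0 < k"
  shows "(\<chi> i. real (z i) / real k) \<in> chainlink a l \<longleftrightarrow> z \<in> chain_box cyc_succ (\<lambda>i. k * a i) (k * l)"
proof -
  have 1: "(real (z i) / real k \<le> real (a i)) = (z i \<le> k * a i)" for i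
    using assms by (simp add: divide_le_eq mult.commute flip: of_nat_mult)
  have 2: "(real (z i) / real k - real (z j) / real k \<le> real (a i) - real l)
      = (z i + k * l \<le> z j + k * a i)" for i j
  proof -
    have "(real (z i) / real k - real (z j) / real k \<le> real (a i) - real l)
      = (real (z i + k * l) \<le> real (z j + k * a i))"
      using assms by (simp add: field_simps)
    then show ?thesis by (simp only: of_nat_le_iff)
  qed
  show ?thesis by (simp add: chainlink_def chain_box_def 1 2)
qed

text \<open>The level condition is stated over the reals, since \<open>real k * t\<close> need not
  be an integer.\<close>

lemma ehrhart_count_section:
  assumes k: "0 < k"
  shows "ehrhart_count (chainlink_section a l t) k =
    card {z \<in> chain_box cyc_succ (\<lambda>i. k * a i) (k * l). real (\<Sum>i\<in>UNIV. z i) = real k * t}"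
proof -
  let ?C = "{z \<in> chain_box cyc_succ (\<lambda>i. k * a i) (k * l). real (\<Sum>i\<in>UNIV. z i) = real k * t}"
  let ?e = "\<lambda>z. \<chi> i. real (z i)"
  have eq: "?e z = real k *\<^sub>R (\<chi> i. real (z i) / real k)" for z :: "'a \<Rightarrow> nat"
    using k by (simp add: vec_eq_iff)
  have sum: "(\<Sum>i\<in>UNIV. real (z i) / real k) = t \<longleftrightarrow> real (\<Sum>i\<in>UNIV. z i) = real k * t" for z :: "'a \<Rightarrow> nat"
    using k by (simp add: field_simps flip: sum_divide_distrib)
  have "(\<lambda>x. real k *\<^sub>R x) ` chainlink_section a l t \<inter> lattice_points = ?e ` ?C"
  proof (intro equalityI subsetI)
    fix y assume "y \<in> (\<lambda>x. real k *\<^sub>R x) ` chainlink_section a l t \<inter> lattice_points"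
    then obtain x where x: "y = real k *\<^sub>R x" "x \<in> chainlink_section a l t" and y: "y \<in> lattice_points"
      by auto
    define z where "z i = nat \<lfloor>y $ i\<rfloor>" for i
    have "0 \<le> y $ i" for i using x by (simp add: chainlink_section_def chainlink_def)
    then have yz: "y $ i = real (z i)" for i
      using y by (simp add: z_def lattice_points_def)
    then have xz: "x = (\<chi> i. real (z i) / real k)"
      using x(1) k by (simp add: vec_eq_iff flip: yz)
    have "z \<in> ?C"
      using x(2) unfolding xz chainlink_section_def
      by (simp add: scaled_mem_chainlink_iff[OF k] sum)
    then show "y \<in> ?e ` ?C" using yz by (intro image_eqI[of _ _ z]) (auto simp: vec_eq_iff)
  next
    fix y assume "y \<in> ?e ` ?C"
    then obtain z where y: "y = ?e z" and z: "z \<in> ?C" by blast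
    have "(\<chi> i. real (z i) / real k) \<in> chainlink_section a l t"
      using z unfolding chainlink_section_def
      by (simp add: scaled_mem_chainlink_iff[OF k] sum)
    then show "y \<in> (\<lambda>x. real k *\<^sub>R x) ` chainlink_section a l t \<inter> lattice_points"
      unfolding y lattice_points_def by (auto simp: eq intro: image_eqI)
  qed
  moreover have "inj_on ?e ?C" by (auto simp: inj_on_def vec_eq_iff)
  ultimately show ?thesis by (simp add: ehrhart_count_def card_image)
qed

text \<open>If \<open>real k * t\<close> is a natural number at most \<open>k * n\<close>, the two
  counts belong to complementary levels of one chain box; otherwise both counted sets are
  empty.\<close>

lemma ehrhart_count_complementary:
  assumes a: "(\<Sum>i\<in>UNIV. a i) = n" and l: "\<And>i. 2 * l \<le> a i" and k: "0 < k"
  shows "ehrhart_count (chainlink_section a l t) k = ehrhart_count (chainlink_section a l (real n - t)) k"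
proof -
  let ?B = "chain_box cyc_succ (\<lambda>i. k * a i) (k * l)"
  have N: "(\<Sum>i\<in>UNIV. k * a i) = k * n" by (simp add: a flip: sum_distrib_left)
  have L: "2 * (k * l) \<le> k * a i" for i using l[of i] by simp
  have le: "(\<Sum>i\<in>UNIV. z i) \<le> k * n" if "z \<in> ?B" for z
    using chain_box_sum_le[OF that] N by simp
  have flip: "real s = real k * (real n - t) \<longleftrightarrow> real (k * n - s) = real k * t" if "s \<le> k * n" for s
    using that by (auto simp: of_nat_diff algebra_simps)
  show ?thesis
  proof (cases "\<exists>m \<le> k * n. real m = real k * t")
    case True
    then obtain m where m: "m \<le> k * n" "real m = real k * t" by blast
    have "{z \<in> ?B. real (\<Sum>i\<in>UNIV. z i) = real k * t} = chain_level cyc_succ (\<lambda>i. k * a i) (k * l) m"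
      unfolding chain_level_def m(2)[symmetric] of_nat_eq_iff ..
    moreover have "{z \<in> ?B. real (\<Sum>i\<in>UNIV. z i) = real k * (real n - t)}
        = chain_level cyc_succ (\<lambda>i. k * a i) (k * l) (k * n - m)"
    proof -
      have "real (\<Sum>i\<in>UNIV. z i) = real k * (real n - t) \<longleftrightarrow> (\<Sum>i\<in>UNIV. z i) = k * n - m" if "z \<in> ?B" for z
        unfolding flip[OF le[OF that]] m(2)[symmetric] of_nat_eq_iff using le[OF that] m(1) by auto
      then show ?thesis unfolding chain_level_def by blast
    qed
    ultimately show ?thesis
      unfolding ehrhart_count_section[OF k]
      using card_chain_level_symmetric[OF inj_cyc_succ, of "k * l" "\<lambda>i. k * a i" m] L m(1)
      by (simp add: N)
  next
    case False
    have "real (\<Sum>i\<in>UNIV. z i) \<noteq> real k * t" "real (\<Sum>i\<in>UNIV. z i) \<noteq> real k * (real n - t)"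
      if "z \<in> ?B" for z
      using False le[OF that] flip[OF le[OF that]] by (blast, metis diff_le_self)
    then show ?thesis
      unfolding ehrhart_count_section[OF k] by (metis (mono_tags, lifting) Collect_cong)
  qed
qed

section \<open>Volumes of sections as limits of lattice point counts\<close>

text \<open>The orthogonal projection onto the hyperplane with coordinate sum
  \<open>t\<close>.\<close>

definition hyperplane_proj :: "real \<Rightarrow> real ^ 'n::finite \<Rightarrow> real ^ 'n" where
  "hyperplane_proj t x = (\<chi> i. x $ i - ((\<Sum>j\<in>UNIV. x $ j) - t) / real CARD('n))"

text \<open>The signed distance from that hyperplane along \<open>unit_normal\<close>.\<close>

definition height :: "real \<Rightarrow> real ^ 'n::finite \<Rightarrow> real" where
  "height t x = ((\<Sum>j\<in>UNIV. x $ j) - t) / sqrt (real CARD('n))"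

lemma sum_hyperplane_proj: "(\<Sum>i\<in>UNIV. hyperplane_proj t x $ i) = t"
  for x :: "real ^ 'n::finite"
  by (simp add: hyperplane_proj_def sum_subtractf)

lemma hyperplane_proj_add_height:
  "hyperplane_proj t x + height t x *\<^sub>R unit_normal = x" for x :: "real ^ 'n::finite"
  by (simp add: vec_eq_iff hyperplane_proj_def height_def unit_normal_def)

lemma mem_right_prism_section_iff:
  fixes a :: "'n::{finite,linorder} \<Rightarrow> nat"
  shows "x \<in> right_prism (chainlink_section a l t) \<longleftrightarrow>
    0 \<le> height t x \<and> height t x \<le> 1 \<and> hyperplane_proj t x \<in> chainlink a l"
proof
  assume "x \<in> right_prism (chainlink_section a l t)"
  then obtain y u where x: "x = y + u *\<^sub>R unit_normal" and y: "y \<in> chainlink a l"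
    and t: "(\<Sum>i\<in>UNIV. y $ i) = t" and u: "0 \<le> u" "u \<le> 1"
    by (auto simp: right_prism_def chainlink_section_def)
  have "(\<Sum>i\<in>UNIV. x $ i) = t + u * (real CARD('n) / sqrt (real CARD('n)))"
    by (simp add: x sum.distrib t unit_normal_def)
  then have "(\<Sum>i\<in>UNIV. x $ i) = t + u * sqrt (real CARD('n))"
    by (simp only: real_div_sqrt of_nat_0_le_iff)
  then have "height t x = u" by (simp add: height_def)
  moreover from this have "hyperplane_proj t x = y"
    using hyperplane_proj_add_height[of t x] x by simp
  ultimately show "0 \<le> height t x \<and> height t x \<le> 1 \<and> hyperplane_proj t x \<in> chainlink a l"
    using u y by simp
next
  assume "0 \<le> height t x \<and> height t x \<le> 1 \<and> hyperplane_proj t x \<in> chainlink a l"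
  then show "x \<in> right_prism (chainlink_section a l t)"
    unfolding right_prism_def chainlink_section_def
    by (intro CollectI exI[of _ "hyperplane_proj t x"] exI[of _ "height t x"])
       (auto simp: hyperplane_proj_add_height sum_hyperplane_proj)
qed

text \<open>Cells control every projected coordinate except the \<open>i\<close>-th; that one is
  recovered from the coordinate sum \<open>t\<close>, and the normal part adds at most 1.\<close>

lemma prism_coordinate_bound:
  fixes x :: "real ^ 'n::finite"
  assumes C: "0 \<le> C" and h: "0 \<le> height t x" "height t x \<le> 1"
    and p: "\<And>j. j \<noteq> i \<Longrightarrow> \<bar>hyperplane_proj t x $ j\<bar> \<le> C"
  shows "\<bar>x $ j\<bar> \<le> \<bar>t\<bar> + real CARD('n) * C + 1"
proof -
  let ?p = "hyperplane_proj t x" and ?s = "real CARD('n)"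
  have s: "1 \<le> ?s" using zero_less_card_finite[where 'a = 'n] by simp
  have "?p $ i = t - (\<Sum>j\<in>- {i}. ?p $ j)"
    using sum_hyperplane_proj[of t x] sum.remove[of UNIV i "\<lambda>j. ?p $ j"]
    by (simp add: Compl_eq_Diff_UNIV)
  moreover have "\<bar>\<Sum>j\<in>- {i}. ?p $ j\<bar> \<le> real (card (- {i})) * C"
    by (rule order_trans[OF sum_abs sum_bounded_above]) (auto intro: p)
  moreover have "real (card (- {i})) * C \<le> ?s * C"
    using C by (intro mult_right_mono) (auto intro: card_mono)
  ultimately have "\<bar>?p $ i\<bar> \<le> \<bar>t\<bar> + ?s * C" by linarith
  moreover have "\<bar>?p $ j\<bar> \<le> \<bar>t\<bar> + ?s * C" if "j \<noteq> i"
    using p[OF that] mult_right_mono[OF s C] by linarith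
  ultimately have "\<bar>?p $ j\<bar> \<le> \<bar>t\<bar> + ?s * C" by blast
  moreover have "x $ j = ?p $ j + height t x / sqrt ?s"
    by (subst hyperplane_proj_add_height[of t x, symmetric]) (simp add: unit_normal_def)
  moreover have "0 \<le> height t x / sqrt ?s" using h s by simp
  moreover have "height t x / sqrt ?s \<le> 1 / 1" using h s by (intro frac_le) auto
  ultimately show ?thesis by linarith
qed

text \<open>
  The part of the prism that rounds to a given lattice point: a point is located by its height and
  by all coordinates of its projection except the \<open>i\<close>-th.  The shape does not depend on \<open>t\<close>, so its
  volume need not be computed.
\<close>

definition cell :: "'n \<Rightarrow> nat \<Rightarrow> (real ^ 'n::finite) set" where
  "cell i k = {x. 0 \<le> height 0 x \<and> height 0 x \<le> 1 \<and>
     (\<forall>j. j \<noteq> i \<longrightarrow> 0 \<le> real k * hyperplane_proj 0 x $ j \<and> real k * hyperplane_proj 0 x $ j < 1)}"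

lemma lmeasurable_cell:
  assumes k: "0 < k"
  shows "cell i k \<in> lmeasurable"
proof (rule bounded_set_imp_lmeasurable)
  have "\<bar>hyperplane_proj 0 x $ j\<bar> \<le> 1" if "x \<in> cell i k" "j \<noteq> i" for x j
  proof -
    let ?p = "hyperplane_proj 0 x $ j"
    have p: "0 \<le> real k * ?p" "real k * ?p < 1" using that by (auto simp: cell_def)
    then have "0 \<le> ?p" using k by (simp add: zero_le_mult_iff)
    moreover from this have "1 * ?p \<le> real k * ?p" using k by (intro mult_right_mono) auto
    ultimately show ?thesis using p by linarith
  qed
  then have b: "\<bar>x $ j\<bar> \<le> \<bar>0\<bar> + real CARD('a) * 1 + 1" if "x \<in> cell i k" for x j
    using that by (intro prism_coordinate_bound[of 1 0 x i]) (auto simp: cell_def)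
  have "cell i k \<subseteq> cbox (\<chi> j. - (real CARD('a) + 1)) (\<chi> j. real CARD('a) + 1)"
  proof
    fix x assume x: "x \<in> cell i k"
    have "- (real CARD('a) + 1) \<le> x $ j \<and> x $ j \<le> real CARD('a) + 1" for j
      using b[OF x, of j] by linarith
    then show "x \<in> cbox (\<chi> j. - (real CARD('a) + 1)) (\<chi> j. real CARD('a) + 1)"
      unfolding mem_box_cart vec_lambda_beta by blast
  qed
  then show "bounded (cell i k)" by (rule bounded_subset[OF bounded_cbox])
  let ?C = "{x. 0 \<le> height 0 x} \<inter> {x. height 0 x \<le> 1} \<inter>
      (\<Inter>j\<in>-{i}. {x. 0 \<le> real k * hyperplane_proj 0 x $ j})"
  let ?O = "\<Inter>j\<in>-{i}. {x. real k * hyperplane_proj 0 x $ j < 1}"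
  have "closed ?C"
    unfolding height_def hyperplane_proj_def vec_lambda_beta
    by (intro closed_Int closed_INT ballI closed_Collect_le continuous_intros) auto
  moreover have "open ?O"
    unfolding hyperplane_proj_def vec_lambda_beta
    by (intro open_INT ballI open_Collect_less continuous_intros) auto
  moreover have "cell i k = ?C \<inter> ?O"
    by (auto simp: cell_def)
  ultimately have "cell i k \<in> sets borel"
    by (metis borel_closed borel_open sets.Int)
  then show "cell i k \<in> sets lebesgue" by (simp add: sets_completionI_sets)
qed

section \<open>Boundary null sets and stability of membership\<close>

text \<open>The projected coordinate is affine in \<open>x\<close>, its linear part being the
  \<open>i\<close>-th coordinate minus the mean. In dimension at least 2 this is nonzero, because
  its entries away from \<open>i\<close> are \<open>- 1 / CARD('n)\<close>.\<close>

lemma negligible_hyperplane_proj_level: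
  assumes "2 \<le> CARD('n::finite)"
  shows "negligible {x :: real ^ 'n. hyperplane_proj t x $ i = b}"
proof -
  define c :: "real ^ 'n" where "c = axis i 1 - (\<chi> j. 1 / real CARD('n))"
  obtain j where "j \<noteq> i"
    using assms by (metis UNIV_I card_le_Suc0_iff_eq finite not_less_eq_eq numeral_2_eq_2)
  then have "c $ j \<noteq> 0" by (simp add: c_def axis_def)
  then have "c \<noteq> 0" by auto
  then have "negligible {x. c \<bullet> x = b - t / real CARD('n)}"
    by (intro negligible_hyperplane) simp
  moreover have "c \<bullet> x = x $ i - (\<Sum>j\<in>UNIV. x $ j) / real CARD('n)" for x
    by (simp add: c_def inner_diff_left inner_axis' inner_vec_def[of "\<chi> j. _"] sum_divide_distrib)
  ultimately show ?thesis
    by (simp add: hyperplane_proj_def diff_divide_distrib algebra_simps)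
qed

lemma negligible_hyperplane_proj_diff_level:
  assumes "i \<noteq> j"
  shows "negligible {x :: real ^ 'n::finite. hyperplane_proj t x $ i - hyperplane_proj t x $ j = b}"
proof -
  let ?c = "axis i 1 - axis j 1 :: real ^ 'n"
  have "?c $ i \<noteq> 0" using assms by (simp add: axis_def)
  then have "?c \<noteq> 0" by (metis zero_index)
  then have "negligible {x. ?c \<bullet> x = b}"
    by (intro negligible_hyperplane) simp
  then show ?thesis
    by (simp add: hyperplane_proj_def inner_diff_left inner_axis')
qed

lemma floor_scaled_tendsto: "(\<lambda>k. real_of_int \<lfloor>real (Suc k) * p\<rfloor> / real (Suc k)) \<longlonglongrightarrow> p"
proof (rule tendsto_sandwich)
  show "\<forall>\<^sub>F k in sequentially. p - 1 / real (Suc k) \<le> real_of_int \<lfloor>real (Suc k) * p\<rfloor> / real (Suc k)"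
  proof (intro always_eventually allI)
    fix k
    have "real (Suc k) * p - 1 \<le> real_of_int \<lfloor>real (Suc k) * p\<rfloor>" by linarith
    then have "(real (Suc k) * p - 1) / real (Suc k) \<le> real_of_int \<lfloor>real (Suc k) * p\<rfloor> / real (Suc k)"
      by (rule divide_right_mono) simp
    then show "p - 1 / real (Suc k) \<le> real_of_int \<lfloor>real (Suc k) * p\<rfloor> / real (Suc k)"
      by (simp add: diff_divide_distrib)
  qed
  show "\<forall>\<^sub>F k in sequentially. real_of_int \<lfloor>real (Suc k) * p\<rfloor> / real (Suc k) \<le> p"
  proof (intro always_eventually allI)
    fix k
    have "real_of_int \<lfloor>real (Suc k) * p\<rfloor> / real (Suc k) \<le> (real (Suc k) * p) / real (Suc k)"
      by (rule divide_right_mono) auto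
    then show "real_of_int \<lfloor>real (Suc k) * p\<rfloor> / real (Suc k) \<le> p" by simp
  qed
  show "(\<lambda>k. p - 1 / real (Suc k)) \<longlonglongrightarrow> p"
    using tendsto_diff[OF tendsto_const[of p] LIMSEQ_inverse_real_of_nat] by (simp add: inverse_eq_divide)
qed simp

lemma chainlinkD:
  assumes "x \<in> chainlink a l"
  shows "0 \<le> x $ i" "x $ i \<le> real (a i)" "x $ i - x $ cyc_succ i \<le> real (a i) - real l"
  using assms by (simp_all add: chainlink_def)

text \<open>Off the boundary hyperplanes each inequality holds strictly or fails strictly at the
  limit, and either persists along the sequence. Where \<open>cyc_succ i = i\<close>, strictness
  comes from \<open>l < a i\<close>.\<close>

lemma eventually_mem_chainlink_iff:
  fixes a :: "'n::{finite,linorder} \<Rightarrow> nat"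
  assumes r: "\<And>i. (\<lambda>k. r k $ i) \<longlonglongrightarrow> p $ i" and l: "\<And>i. l < a i"
    and p: "\<And>i. p $ i \<noteq> 0" "\<And>i. p $ i \<noteq> real (a i)"
      "\<And>i. cyc_succ i \<noteq> i \<Longrightarrow> p $ i - p $ cyc_succ i \<noteq> real (a i) - real l"
  shows "\<forall>\<^sub>F k in sequentially. r k \<in> chainlink a l \<longleftrightarrow> p \<in> chainlink a l"
proof (cases "p \<in> chainlink a l")
  case True
  have rd: "(\<lambda>k. r k $ i - r k $ j) \<longlonglongrightarrow> p $ i - p $ j" for i j
    by (intro tendsto_diff r)
  have "\<forall>\<^sub>F k in sequentially. \<forall>i. 0 \<le> r k $ i \<and> r k $ i \<le> real (a i) \<and>
      r k $ i - r k $ (cyc_succ i) \<le> real (a i) - real l"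
  proof (intro eventually_all_finite eventually_conj)
    fix i
    have i: "0 < p $ i" "p $ i < real (a i)"
      using True p(1,2)[of i] by (auto simp: chainlink_def order_less_le)
    have d: "p $ i - p $ cyc_succ i < real (a i) - real l"
    proof (cases "cyc_succ i = i")
      case False
      then show ?thesis using True p(3) by (auto simp: chainlink_def order_less_le)
    qed (simp add: l)
    show "\<forall>\<^sub>F k in sequentially. 0 \<le> r k $ i"
      using order_tendstoD(1)[OF r i(1)] by eventually_elim simp
    show "\<forall>\<^sub>F k in sequentially. r k $ i \<le> real (a i)"
      using order_tendstoD(2)[OF r i(2)] by eventually_elim simp
    show "\<forall>\<^sub>F k in sequentially. r k $ i - r k $ (cyc_succ i) \<le> real (a i) - real l"
      using order_tendstoD(2)[OF rd d] by eventually_elim simp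
  qed
  then show ?thesis by eventually_elim (use True in \<open>simp add: chainlink_def\<close>)
next
  case False
  then obtain i where "p $ i < 0 \<or> real (a i) < p $ i \<or> real (a i) - real l < p $ i - p $ cyc_succ i"
    by (auto simp: chainlink_def not_le)
  then have "\<forall>\<^sub>F k in sequentially. r k \<notin> chainlink a l"
  proof (elim disjE)
    assume "p $ i < 0"
    from order_tendstoD(2)[OF r this] show ?thesis
      by eventually_elim (metis chainlinkD(1) not_le)
  next
    assume "real (a i) < p $ i"
    from order_tendstoD(1)[OF r this] show ?thesis
      by eventually_elim (metis chainlinkD(2) not_le)
  next
    assume "real (a i) - real l < p $ i - p $ cyc_succ i"
    from order_tendstoD(1)[OF tendsto_diff[OF r r] this] show ?thesis
      by eventually_elim (metis chainlinkD(3) not_le)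
  qed
  then show ?thesis by eventually_elim (use False in simp)
qed

section \<open>Approximating the prism by translated cells\<close>

text \<open>Agrees with \<open>z / k\<close> off \<open>i\<close>; the \<open>i\<close>-th
  coordinate is corrected so that the translated cell starts on the hyperplane with sum
  \<open>t\<close>, whatever the sum of \<open>z / k\<close> is.\<close>

definition cell_shift :: "'n \<Rightarrow> real \<Rightarrow> nat \<Rightarrow> ('n \<Rightarrow> nat) \<Rightarrow> real ^ 'n::finite" where
  "cell_shift i t k z = (\<chi> j. if j = i then t - (\<Sum>j\<in>-{i}. real (z j) / real k) else real (z j) / real k)"

definition cell_union ::
    "('n::{finite,linorder} \<Rightarrow> nat) \<Rightarrow> nat \<Rightarrow> 'n \<Rightarrow> real \<Rightarrow> nat \<Rightarrow> nat \<Rightarrow> (real ^ 'n::{finite,linorder}) set"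
  where
  "cell_union a l i t k m =
     (\<Union>z\<in>chain_level cyc_succ (\<lambda>i. k * a i) (k * l) m. (\<lambda>x. cell_shift i t k z + x) ` cell i k)"

lemma sum_cell_shift: "(\<Sum>j\<in>UNIV. cell_shift i t k z $ j) = t"
proof -
  have "(\<Sum>j\<in>UNIV - {i}. cell_shift i t k z $ j) = (\<Sum>j\<in>-{i}. real (z j) / real k)"
    by (intro sum.cong) (auto simp: cell_shift_def)
  moreover have "(\<Sum>j\<in>UNIV. cell_shift i t k z $ j)
      = cell_shift i t k z $ i + (\<Sum>j\<in>UNIV - {i}. cell_shift i t k z $ j)"
    by (rule sum.remove) auto
  ultimately show ?thesis by (simp add: cell_shift_def)
qed

text \<open>Translating by a point of coordinate sum \<open>t\<close> turns heights and projections
  relative to 0 into those relative to \<open>t\<close>; the half-open conditions then prescribe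
  floors.\<close>

lemma mem_shifted_cell_iff:
  assumes k: "0 < k"
  shows "x \<in> (\<lambda>x. cell_shift i t k z + x) ` cell i k \<longleftrightarrow>
    0 \<le> height t x \<and> height t x \<le> 1 \<and>
    (\<forall>j. j \<noteq> i \<longrightarrow> \<lfloor>real k * hyperplane_proj t x $ j\<rfloor> = int (z j))"
proof -
  let ?w = "cell_shift i t k z"
  have "x \<in> (\<lambda>x. ?w + x) ` cell i k \<longleftrightarrow> x - ?w \<in> cell i k"
    by (auto intro: image_eqI[of _ _ "x - ?w"])
  moreover have "height 0 (x - ?w) = height t x"
    by (simp add: height_def sum_subtractf sum_cell_shift)
  moreover have "real k * hyperplane_proj 0 (x - ?w) $ j = real k * hyperplane_proj t x $ j - real (z j)"
    if "j \<noteq> i" for j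
  proof -
    have "hyperplane_proj 0 (x - ?w) $ j = hyperplane_proj t x $ j - real (z j) / real k"
      using that
      by (simp only: hyperplane_proj_def vec_lambda_beta vector_minus_component sum_subtractf sum_cell_shift)
        (simp add: cell_shift_def)
    then show ?thesis using k by (simp add: right_diff_distrib)
  qed
  moreover have "(0 \<le> p - real n \<and> p - real n < 1) = (\<lfloor>p\<rfloor> = int n)" for p n
    unfolding floor_eq_iff by auto
  ultimately show ?thesis
    unfolding cell_def by simp
qed

text \<open>A point in two translated cells would give both lattice points the same entries off
  \<open>i\<close>, and the common level \<open>m\<close> then fixes the \<open>i\<close>-th entry.
  So the cells are disjoint translates.\<close>

lemma measure_cell_union:
  assumes k: "0 < k"
  shows "cell_union a l i t k m \<in> sets lebesgue"
    and "measure lebesgue (cell_union a l i t k m) =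
      real (card (chain_level cyc_succ (\<lambda>i. k * a i) (k * l) m)) * measure lebesgue (cell i k)"
proof -
  let ?S = "chain_level cyc_succ (\<lambda>i. k * a i) (k * l) m"
  let ?A = "\<lambda>z. (\<lambda>x. cell_shift i t k z + x) ` cell i k"
  have lm: "?A z \<in> lmeasurable" for z
    by (intro measurable_translation lmeasurable_cell k)
  then show "cell_union a l i t k m \<in> sets lebesgue"
    unfolding cell_union_def
    by (intro sets.finite_UN finite_chain_level fmeasurableD)
  have "disjoint_family_on ?A ?S"
  proof (unfold disjoint_family_on_def, intro ballI impI, rule ccontr)
    fix y z assume yz: "y \<in> ?S" "z \<in> ?S" "y \<noteq> z" and "?A y \<inter> ?A z \<noteq> {}"
    then obtain x where x: "x \<in> ?A y" "x \<in> ?A z" by blast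
    have eq: "y j = z j" if "j \<noteq> i" for j
      using x that unfolding mem_shifted_cell_iff[OF k] by (metis of_nat_eq_iff)
    have "(\<Sum>j\<in>UNIV. y j) = (\<Sum>j\<in>UNIV. z j)"
      using yz by (simp add: chain_level_def)
    moreover have "(\<Sum>j\<in>UNIV - {i}. y j) = (\<Sum>j\<in>UNIV - {i}. z j)"
      using eq by (intro sum.cong) auto
    ultimately have "y i = z i"
      by (simp add: sum.remove[of UNIV i])
    with eq have "y = z" by (intro ext) metis
    with yz show False by simp
  qed
  then have "measure lebesgue (\<Union>z\<in>?S. ?A z) = (\<Sum>z\<in>?S. measure lebesgue (?A z))"
    using fmeasurableD[OF lm] fmeasurableD2[OF lm]
    by (intro measure_finite_Union finite_chain_level) (auto simp: top.not_eq_extremum)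
  then show "measure lebesgue (cell_union a l i t k m) = real (card ?S) * measure lebesgue (cell i k)"
    by (simp add: cell_union_def measure_translation)
qed

text \<open>The \<open>i\<close>-th coordinate is chosen so that the sum of the coordinates is \<open>m / k\<close>.\<close>

definition lattice_rounding :: "'n \<Rightarrow> real \<Rightarrow> nat \<Rightarrow> nat \<Rightarrow> real ^ 'n::finite \<Rightarrow> real ^ 'n" where
  "lattice_rounding i t k m x = (\<chi> j. of_int (if j = i
     then int m - (\<Sum>j\<in>-{i}. \<lfloor>real k * hyperplane_proj t x $ j\<rfloor>)
     else \<lfloor>real k * hyperplane_proj t x $ j\<rfloor>) / real k)"

text \<open>A lattice point whose cell contains \<open>x\<close> is forced: floors off
  \<open>i\<close>, and the level \<open>m\<close> at \<open>i\<close>. Membership in the union thus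
  tests a single rounded point.\<close>

lemma mem_cell_union_iff:
  fixes a :: "'n::{finite,linorder} \<Rightarrow> nat"
  assumes k: "0 < k"
  shows "x \<in> cell_union a l i t k m \<longleftrightarrow>
    0 \<le> height t x \<and> height t x \<le> 1 \<and> lattice_rounding i t k m x \<in> chainlink a l"
proof -
  let ?c = "\<lambda>i. k * a i" and ?p = "\<lambda>j. \<lfloor>real k * hyperplane_proj t x $ j\<rfloor>"
  have "(\<exists>z\<in>chain_level cyc_succ ?c (k * l) m. \<forall>j. j \<noteq> i \<longrightarrow> ?p j = int (z j)) \<longleftrightarrow>
      lattice_rounding i t k m x \<in> chainlink a l"
  proof
    assume "\<exists>z\<in>chain_level cyc_succ ?c (k * l) m. \<forall>j. j \<noteq> i \<longrightarrow> ?p j = int (z j)"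
    then obtain z where z: "z \<in> chain_box cyc_succ ?c (k * l)" "(\<Sum>j\<in>UNIV. z j) = m"
      and p: "\<And>j. j \<noteq> i \<Longrightarrow> ?p j = int (z j)" by (auto simp: chain_level_def)
    have "int m - (\<Sum>j\<in>-{i}. ?p j) = int (z i)"
    proof -
      have "(\<Sum>j\<in>-{i}. ?p j) = (\<Sum>j\<in>UNIV - {i}. int (z j))"
        by (intro sum.cong) (auto simp: p)
      moreover have "int m = int (z i) + (\<Sum>j\<in>UNIV - {i}. int (z j))"
        unfolding z(2)[symmetric] of_nat_sum by (rule sum.remove) auto
      ultimately show ?thesis by simp
    qed
    then have "lattice_rounding i t k m x = (\<chi> j. real (z j) / real k)"
      by (simp add: lattice_rounding_def vec_eq_iff p)
    then show "lattice_rounding i t k m x \<in> chainlink a l"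
      using z(1) scaled_mem_chainlink_iff[OF k] by metis
  next
    assume mem: "lattice_rounding i t k m x \<in> chainlink a l"
    \<comment> \<open>The only candidate, as an integer vector; membership in the polytope makes its
      entries nonnegative, so it can be read in \<open>nat\<close>.\<close>
    define w where "w j = (if j = i then int m - (\<Sum>j\<in>-{i}. ?p j) else ?p j)" for j
    define z where "z j = nat (w j)" for j
    have rw: "lattice_rounding i t k m x = (\<chi> j. of_int (w j) / real k)"
      by (simp add: lattice_rounding_def w_def)
    have "0 \<le> w j" for j
    proof -
      have "0 \<le> of_int (w j) / real k" using mem by (simp add: rw chainlink_def)
      then show ?thesis using k by (simp add: zero_le_divide_iff)
    qed
    then have wz: "w j = int (z j)" for j by (simp add: z_def)
    have "int (\<Sum>j\<in>UNIV. z j) = (\<Sum>j\<in>UNIV. w j)" by (simp add: wz)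
    also have "\<dots> = w i + (\<Sum>j\<in>UNIV - {i}. w j)" by (rule sum.remove) auto
    also have "(\<Sum>j\<in>UNIV - {i}. w j) = (\<Sum>j\<in>-{i}. ?p j)"
      by (intro sum.cong) (auto simp: w_def)
    finally have "int (\<Sum>j\<in>UNIV. z j) = int m" by (simp add: w_def del: of_nat_sum)
    then have "(\<Sum>j\<in>UNIV. z j) = m" by (simp only: of_nat_eq_iff)
    moreover have "z \<in> chain_box cyc_succ ?c (k * l)"
      using mem unfolding rw wz by (simp add: scaled_mem_chainlink_iff[OF k])
    moreover have "?p j = int (z j)" if "j \<noteq> i" for j
      using that wz[of j] by (simp add: w_def)
    ultimately show "\<exists>z\<in>chain_level cyc_succ ?c (k * l) m. \<forall>j. j \<noteq> i \<longrightarrow> ?p j = int (z j)"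
      by (auto simp: chain_level_def)
  qed
  then show ?thesis
    unfolding cell_union_def UN_iff mem_shifted_cell_iff[OF k] by blast
qed

lemma lattice_rounding_tendsto:
  assumes m: "(\<lambda>k. real (m k) / real (Suc k)) \<longlonglongrightarrow> t"
  shows "(\<lambda>k. lattice_rounding i t (Suc k) (m k) x $ j) \<longlonglongrightarrow> hyperplane_proj t x $ j"
proof (cases "j = i")
  case False
  then show ?thesis
    using floor_scaled_tendsto by (simp add: lattice_rounding_def del: of_nat_Suc)
next
  case True
  have "(\<lambda>k. real (m k) / real (Suc k) -
      (\<Sum>j\<in>-{i}. of_int \<lfloor>real (Suc k) * hyperplane_proj t x $ j\<rfloor> / real (Suc k)))
      \<longlonglongrightarrow> t - (\<Sum>j\<in>-{i}. hyperplane_proj t x $ j)"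
    by (intro tendsto_diff tendsto_sum m floor_scaled_tendsto)
  moreover have "t - (\<Sum>j\<in>-{i}. hyperplane_proj t x $ j) = hyperplane_proj t x $ i"
    using sum_hyperplane_proj[of t x] sum.remove[of UNIV i "\<lambda>j. hyperplane_proj t x $ j"]
    by (simp add: Compl_eq_Diff_UNIV)
  ultimately show ?thesis
    using True by (simp add: lattice_rounding_def diff_divide_distrib sum_divide_distrib del: of_nat_Suc)
qed

text \<open>The bound is uniform in \<open>k\<close> and \<open>m\<close>, as dominated convergence
  requires: off \<open>i\<close> the rounding error is below \<open>1 / k \<le> 1\<close>.\<close>

lemma cell_union_bound:
  fixes a :: "'n::{finite,linorder} \<Rightarrow> nat"
  assumes k: "0 < k" and x: "x \<in> cell_union a l i t k m"
  shows "\<bar>x $ j\<bar> \<le> \<bar>t\<bar> + real CARD('n) * real (\<Sum>j\<in>UNIV. a j + 1) + 1"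
proof (rule prism_coordinate_bound)
  show "0 \<le> height t x" "height t x \<le> 1" using x by (simp_all add: mem_cell_union_iff[OF k])
  fix j assume j: "j \<noteq> i"
  let ?p = "hyperplane_proj t x $ j"
  have "0 \<le> lattice_rounding i t k m x $ j" "lattice_rounding i t k m x $ j \<le> real (a j)"
    using x by (simp_all add: mem_cell_union_iff[OF k] chainlink_def)
  then have "0 \<le> real_of_int \<lfloor>real k * ?p\<rfloor>" "real_of_int \<lfloor>real k * ?p\<rfloor> \<le> real k * real (a j)"
    using j k by (simp_all add: lattice_rounding_def zero_le_divide_iff divide_le_eq mult.commute)
  then have "0 \<le> real k * ?p" "real k * ?p \<le> real k * real (a j) + 1" by linarith+
  moreover have "real k * real (a j) + 1 \<le> real k * (real (a j) + 1)" using k by (simp add: algebra_simps)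
  ultimately have "0 \<le> real k * ?p" "real k * ?p \<le> real k * (real (a j) + 1)" by linarith+
  then have "0 \<le> ?p" "?p \<le> real (a j) + 1"
    using k by (simp_all add: zero_le_mult_iff)
  moreover have "a j + 1 \<le> (\<Sum>j\<in>UNIV. a j + 1)" by (rule member_le_sum) auto
  then have "real (a j) + 1 \<le> real (\<Sum>j\<in>UNIV. a j + 1)" by linarith
  ultimately show "\<bar>?p\<bar> \<le> real (\<Sum>j\<in>UNIV. a j + 1)" by linarith
qed (rule of_nat_0_le_iff)

text \<open>Off the null set \<open>B\<close> of boundary hyperplanes, the rounded point is
  eventually in the polytope exactly when the projection is. So the indicators of the cell unions
  converge to that of the prism, and dominated convergence gives the measures.\<close>

lemma hyperplane_volume_section_limit:
  fixes a :: "'n::{finite,linorder} \<Rightarrow> nat" and i :: 'n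
  assumes s: "2 \<le> CARD('n)" and l: "\<And>i. l < a i"
    and m: "(\<lambda>k. real (m k) / real (Suc k)) \<longlonglongrightarrow> t"
  shows "(\<lambda>k. real (card (chain_level cyc_succ (\<lambda>i. Suc k * a i) (Suc k * l) (m k)))
      * measure lebesgue (cell i (Suc k))) \<longlonglongrightarrow> hyperplane_volume (chainlink_section a l t)"
proof -
  let ?U = "\<lambda>k. cell_union a l i t (Suc k) (m k)"
  let ?P = "right_prism (chainlink_section a l t)"
  define R where "R = \<bar>t\<bar> + real CARD('n) * real (\<Sum>j\<in>UNIV. a j + 1) + 1"
  let ?Q = "cbox (\<chi> j. - R) (\<chi> j. R) :: (real ^ 'n::{finite,linorder}) set"
  define B where "B = (\<Union>i. {x :: real ^ 'n::{finite,linorder}. hyperplane_proj t x $ i = 0}) \<union>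
    (\<Union>i. {x. hyperplane_proj t x $ i = real (a i)}) \<union>
    (\<Union>i\<in>{i. cyc_succ i \<noteq> i}. {x. hyperplane_proj t x $ i - hyperplane_proj t x $ cyc_succ i = real (a i) - real l})"
  \<comment> \<open>At a fixed point of \<open>cyc_succ\<close> the cyclic inequality holds strictly because \<open>l < a i\<close>, so only
    the other indices contribute to the boundary.\<close>
  have nUN: "negligible (\<Union>i\<in>I. A i)"
    if "\<And>i. i \<in> I \<Longrightarrow> negligible (A i)" for I and A :: "'n \<Rightarrow> (real ^ 'n::{finite,linorder}) set"
    using that by (intro negligible_Union) auto
  have "negligible B"
    unfolding B_def
    by (intro negligible_Un nUN negligible_hyperplane_proj_level
        negligible_hyperplane_proj_diff_level s) (auto simp: eq_commute)
  then have B: "B \<in> null_sets lebesgue" by (simp add: negligible_iff_null_sets)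
  have ev: "\<forall>\<^sub>F k in sequentially. indicator (?U k) x = (indicator ?P x :: real)" if "x \<notin> B" for x
  proof -
    have "\<forall>\<^sub>F k in sequentially. lattice_rounding i t (Suc k) (m k) x \<in> chainlink a l
        \<longleftrightarrow> hyperplane_proj t x \<in> chainlink a l"
      using that by (intro eventually_mem_chainlink_iff lattice_rounding_tendsto m l) (auto simp: B_def)
    then show ?thesis
      by eventually_elim (simp add: indicator_def mem_cell_union_iff mem_right_prism_section_iff)
  qed
  have "(\<lambda>k. integral\<^sup>L lebesgue (indicator (?U k) :: _ \<Rightarrow> real)) \<longlonglongrightarrow> integral\<^sup>L lebesgue (indicator ?P)"
  proof (rule integral_dominated_convergence[where w = "indicator ?Q"])
    have "chainlink a l = (\<Inter>i. {x. 0 \<le> x $ i} \<inter> {x. x $ i \<le> real (a i)} \<inter>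
        {x. x $ i - x $ (cyc_succ i) \<le> real (a i) - real l})"
      by (auto simp: chainlink_def)
    moreover have "closed \<dots>"
      by (intro closed_INT ballI closed_Int closed_Collect_le continuous_intros)
    ultimately have cl: "closed (chainlink a l)" by simp
    have "?P = {x. 0 \<le> height t x} \<inter> {x. height t x \<le> 1} \<inter> hyperplane_proj t -` chainlink a l"
      by (auto simp: mem_right_prism_section_iff)
    also have "\<dots> \<in> sets borel"
      by (intro borel_closed closed_Int closed_Collect_le closed_vimage cl)
        (auto simp: height_def hyperplane_proj_def intro!: continuous_intros)
    finally have "?P \<in> sets lebesgue" by (simp add: sets_completionI_sets)
    then show "(indicator ?P :: _ \<Rightarrow> real) \<in> borel_measurable lebesgue" by simp
    show "(indicator (?U k) :: _ \<Rightarrow> real) \<in> borel_measurable lebesgue" for k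
      by (intro borel_measurable_indicator measure_cell_union(1)) simp
    show "integrable lebesgue (indicator ?Q :: _ \<Rightarrow> real)"
      using fmeasurable_cbox by (simp add: integrable_indicator_iff fmeasurable_def)
    show "AE x in lebesgue. (\<lambda>k. indicator (?U k) x) \<longlonglongrightarrow> (indicator ?P x :: real)"
    proof (rule AE_I'[OF B], rule subsetI, rule ccontr)
      fix x assume "x \<notin> B"
      from tendsto_eventually[OF ev[OF this]]
      show "x \<in> {x \<in> space lebesgue. \<not> (\<lambda>k. indicator (?U k) x) \<longlonglongrightarrow> (indicator ?P x :: real)} \<Longrightarrow> False"
        by simp
    qed
    show "AE x in lebesgue. norm (indicator (?U k) x :: real) \<le> indicator ?Q x" for k
    proof (rule AE_I2)
      fix x
      have "x \<in> ?Q" if "x \<in> ?U k"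
      proof -
        have "- R \<le> x $ j \<and> x $ j \<le> R" for j
          using cell_union_bound[OF zero_less_Suc that, of j] unfolding R_def by linarith
        then show ?thesis unfolding mem_box_cart vec_lambda_beta by blast
      qed
      then show "norm (indicator (?U k) x :: real) \<le> indicator ?Q x"
        by (auto simp: indicator_def)
    qed
  qed
  then show ?thesis
    by (simp add: hyperplane_volume_def measure_cell_union(2) del: mult_Suc of_nat_Suc)
qed

section \<open>Passage to the limit and degenerate cases\<close>

lemma hyperplane_volume_complementary:
  fixes a :: "'n::{finite,linorder} \<Rightarrow> nat"
  assumes s: "2 \<le> CARD('n)" and a: "(\<Sum>i\<in>UNIV. a i) = n" and l: "0 < l" "\<And>i. 2 * l \<le> a i"
    and t: "0 \<le> t" "t \<le> real n"
  shows "hyperplane_volume (chainlink_section a l t) = hyperplane_volume (chainlink_section a l (real n - t))"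
proof -
  obtain i :: 'n where True by simp
  \<comment> \<open>The complementary level will be \<open>Suc k * n - m k\<close> rather than a
    second floor, so that the level symmetry applies exactly for each \<open>k\<close>.\<close>
  define m where "m k = nat \<lfloor>real (Suc k) * t\<rfloor>" for k
  define c where "c k m = real (card (chain_level cyc_succ (\<lambda>i. Suc k * a i) (Suc k * l) m))
      * measure lebesgue (cell i (Suc k))" for k m
  have l': "l < a i" for i using l(1) l(2)[of i] by linarith
  have mt: "(\<lambda>k. real (m k) / real (Suc k)) \<longlonglongrightarrow> t"
    using floor_scaled_tendsto[of t] t by (simp add: m_def del: of_nat_Suc)
  have mn: "m k \<le> Suc k * n" for k
  proof -
    have "real (Suc k) * t \<le> real (Suc k) * real n" using t by (intro mult_left_mono) auto
    then have "real (Suc k) * t \<le> of_int (int (Suc k * n))"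
      by (simp only: of_int_of_nat_eq of_nat_mult of_int_mult)
    then have "\<lfloor>real (Suc k) * t\<rfloor> \<le> int (Suc k * n)" unfolding floor_le_iff by linarith
    then show ?thesis by (simp add: m_def nat_le_iff del: of_nat_Suc mult_Suc)
  qed
  have "real (Suc k * n - m k) / real (Suc k) = real n - real (m k) / real (Suc k)" for k
    using mn[of k] by (simp add: of_nat_diff diff_divide_distrib del: of_nat_Suc mult_Suc)
  then have mt': "(\<lambda>k. real (Suc k * n - m k) / real (Suc k)) \<longlonglongrightarrow> real n - t"
    using tendsto_diff[OF tendsto_const mt] by simp
  have "c k (Suc k * n - m k) = c k (m k)" for k
  proof -
    have "(\<Sum>i\<in>UNIV. Suc k * a i) = Suc k * n" by (simp only: a flip: sum_distrib_left)
    moreover have "2 * (Suc k * l) \<le> Suc k * a i" for i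
      using mult_le_mono2[OF l(2), of "Suc k" i] by (simp only: mult.left_commute)
    ultimately show ?thesis
      using card_chain_level_symmetric[OF inj_cyc_succ, of "Suc k * l" "\<lambda>i. Suc k * a i" "m k"] mn[of k]
      by (simp only: c_def)
  qed
  moreover have "(\<lambda>k. c k (m k)) \<longlonglongrightarrow> hyperplane_volume (chainlink_section a l t)"
    unfolding c_def by (rule hyperplane_volume_section_limit[OF s l' mt])
  moreover have "(\<lambda>k. c k (Suc k * n - m k)) \<longlonglongrightarrow> hyperplane_volume (chainlink_section a l (real n - t))"
    unfolding c_def by (rule hyperplane_volume_section_limit[OF s l' mt'])
  ultimately show ?thesis by (simp add: LIMSEQ_unique)
qed

lemma hyperplane_volume_translation:
  "hyperplane_volume ((\<lambda>x. w + x) ` P) = hyperplane_volume P"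
proof -
  have "right_prism ((\<lambda>x. w + x) ` P) = (\<lambda>x. w + x) ` right_prism P"
    unfolding right_prism_eq by (force simp: image_iff algebra_simps)
  then show ?thesis by (simp add: hyperplane_volume_def measure_translation)
qed

lemma chainlink_section_eq_empty:
  assumes "(\<Sum>i\<in>UNIV. a i) = n" and "t < 0 \<or> real n < t"
  shows "chainlink_section a l t = {}"
proof -
  have "0 \<le> (\<Sum>i\<in>UNIV. x $ i) \<and> (\<Sum>i\<in>UNIV. x $ i) \<le> real n" if "x \<in> chainlink a l" for x
    unfolding assms(1)[symmetric] of_nat_sum
    using that by (auto simp: chainlink_def intro!: sum_nonneg sum_mono)
  then show ?thesis using assms(2) by (force simp: chainlink_section_def)
qed

text \<open>In dimension one the projection is constant, so boundary sets need not be null and the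
  limit argument fails; the section is a point instead.\<close>

lemma chainlink_section_dim_one:
  fixes a :: "'n::{finite,linorder} \<Rightarrow> nat"
  assumes s: "CARD('n) = 1" and a: "(\<Sum>i\<in>UNIV. a i) = n" and l: "\<And>i. l \<le> a i"
    and t: "0 \<le> t" "t \<le> real n"
  shows "chainlink_section a l t = {\<chi> i. t}"
proof -
  obtain i :: 'n where U: "UNIV = {i}" using s card_1_singletonE by blast
  have all: "j = i" for j using U by auto
  have allq: "(\<forall>j. P j) \<longleftrightarrow> P i" for P by (metis all)
  have "cyc_succ i = i" by (rule all)
  moreover have "a i = n" using a by (simp add: U)
  ultimately show ?thesis
    using l[of i] t unfolding chainlink_section_def chainlink_def vec_eq_iff set_eq_iff
    by (auto simp: U allq vec_eq_iff)
qed

theorem theorem4p8: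
  fixes a :: "'n::{finite,linorder} \<Rightarrow> nat" and n l :: nat and t :: real
  assumes "composition a n"
    and "0 < l"
    and "2 * l \<le> Min (range a)"
    and "0 < t"
  shows "relative_volume (chainlink_section a l t) =
           relative_volume (chainlink_section a l (real n - t))
         \<and> (\<forall>k::nat. 0 < k \<longrightarrow>
              ehrhart_count (chainlink_section a l t) k =
              ehrhart_count (chainlink_section a l (real n - t)) k)"
proof -
  have a: "(\<Sum>i\<in>UNIV. a i) = n" using assms(1) by (simp add: composition_def)
  have l: "2 * l \<le> a i" for i using assms(3) by simp
  then have l': "l \<le> a i" for i by (metis add_leD1 mult_2)
  have "hyperplane_volume (chainlink_section a l t) = hyperplane_volume (chainlink_section a l (real n - t))"
  proof (cases "t \<le> real n")
    case False
    \<comment> \<open>For \<open>t > n\<close> the complementary level is negative, and both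
      sections are empty.\<close>
    then show ?thesis using assms(4) by (simp add: chainlink_section_eq_empty[OF a])
  next
    case t: True
    show ?thesis
    proof (cases "2 \<le> CARD('n)")
      case True
      show ?thesis
        by (rule hyperplane_volume_complementary[OF True a assms(2) l less_imp_le[OF assms(4)] t])
    next
      case False
      moreover have "0 < CARD('n)" by simp
      ultimately have s: "CARD('n) = 1" by linarith
      \<comment> \<open>Both sections are single points, differing by the translation
        \<open>n - 2 * t\<close>.\<close>
      have "chainlink_section a l (real n - t) = (\<lambda>x. (\<chi> i. real n - 2 * t) + x) ` chainlink_section a l t"
        using t assms(4) by (simp add: chainlink_section_dim_one[OF s a l'] vec_eq_iff)
      then show ?thesis by (simp add: hyperplane_volume_translation)
    qed
  qed
  then have "relative_volume (chainlink_section a l t) = relative_volume (chainlink_section a l (real n - t))"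
    unfolding relative_volume_def by (rule arg_cong)
  then show ?thesis
    using ehrhart_count_complementary[OF a l] by blast
qed

end
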